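(* Let $S=\langle U,\iota\rangle$ be an arbitrary $3$-valued structure with $U=\{u_1,\dots,u_n\}$. Let $V_1,\dots,V_n$ be monadic second-order (set) variables and put $\mathit{node}^S_{u_i}(w):=(w\in V_i)$. Define the existential monadic second-order formula $$\eta^S:=\exists V_1,\dots,V_n.\ \bigwedge_{i=1}^n\exists w_i.\,w_i\in V_i\ \wedge\ \bigwedge_{k\neq j}\forall w_1,w_2.\,(w_1\in V_k\wedge w_2\in V_j\Rightarrow\neg eq(w_1,w_2))\ \wedge\ \forall w.\bigvee_{i=1}^n w\in V_i\ \wedge\ \bigwedge_{p\in\mathcal{P}_0}p^{\iota(p)()}\ \wedge\ \bigwedge_{r=1}^{\mathit{maxR}}\bigwedge_{p\in\mathcal{P}_r}\forall w_1,\dots,w_r.\bigwedge_{(u'_1,\dots,u'_r)\in U^r}\Big(\bigwedge_{j=1}^r\mathit{node}^S_{u'_j}(w_j)\Rightarrow p^{\iota(p)(u'_1,\dots,u'_r)}(w_1,\dots,w_r)\Big),$$ and $\widehat{\gamma}_{NP}(S):=F\wedge\eta^S$. Then for every $2$-valued structure $S^\natural$: $S^\natural\in\gamma(S)$ iff $S^\natural\models\widehat{\gamma}_{NP}(S)$.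
   Context: Fix a finite vocabulary $\mathcal{P}$ of predicate symbols containing a designated binary symbol $eq$; $\mathcal{P}_i$ denotes the symbols of arity $i$, $\mathit{maxR}$ the maximal arity. Fix a closed formula $F$ of first-order logic with transitive closure over $\mathcal{P}$ (the integrity formula). A $2$-valued structure is $\langle U,\iota\rangle$ with $\iota(p):U^i\to\{0,1\}$ for $p\in\mathcal{P}_i$, $\iota(eq)$ being equality. A $3$-valued structure has $\iota(p):U^i\to\{0,1,1/2\}$, with $\iota(eq)(u,u)\in\{1,1/2\}$ and $\iota(eq)(u_1,u_2)=0$ for distinct $u_1,u_2$. Information order: $l_1\sqsubseteq l_2$ iff $l_1=l_2$ or $l_2=1/2$. A surjective $f:U^S\to U^{S'}$ embeds $S$ into $S'$ if $\iota^S(p)(u_1,\dots,u_i)\sqsubseteq\iota^{S'}(p)(f(u_1),\dots,f(u_i))$ for all $p\in\mathcal{P}_i$ and all $u_1,\dots,u_i$. $\gamma(S)$ is the set of $2$-valued structures $S^\natural$ with $S^\natural\models F$ that embed into $S$. For a $k$-ary $p$ and $B\in\{0,1,1/2\}$: $p^0(\bar v):=\neg p(\bar v)$, $p^1(\bar v):=p(\bar v)$, $p^{1/2}(\bar v):=\mathit{true}$ (for nullary $p$ the argument list is empty). *)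

theory Defs
  imports Main
begin

section \<open>Vocabularies and structures\<close>

record 'p vocab =
  preds :: "'p set"
  arity :: "'p \<Rightarrow> nat"
  eqsym :: 'p

definition vocabulary :: "'p vocab \<Rightarrow> bool" where
  "vocabulary V \<longleftrightarrow> finite (preds V) \<and> eqsym V \<in> preds V \<and> arity V (eqsym V) = 2"

definition preds_of_arity :: "'p vocab \<Rightarrow> nat \<Rightarrow> 'p set" where
  "preds_of_arity V i = {p \<in> preds V. arity V p = i}"

definition maxR :: "'p vocab \<Rightarrow> nat" where
  "maxR V = Max (arity V ` preds V)"

datatype truth = Zero | One | Half

definition info_le :: "truth \<Rightarrow> truth \<Rightarrow> bool" (infix "\<sqsubseteq>" 50) where
  "l1 \<sqsubseteq> l2 \<longleftrightarrow> l1 = l2 \<or> l2 = Half"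

text \<open>
  Structures of both kinds share one record type. Only the values of \<open>interp\<close> at symbols of the
  vocabulary and at tuples over the universe of matching length are meaningful. The universe may
  be empty.
\<close>

record ('p, 'u) struct =
  universe :: "'u set"
  interp :: "'p \<Rightarrow> 'u list \<Rightarrow> truth"

definition tuples :: "'u set \<Rightarrow> nat \<Rightarrow> 'u list set" where
  "tuples U k = {us. length us = k \<and> set us \<subseteq> U}"

definition two_valued :: "'p vocab \<Rightarrow> ('p, 'u) struct \<Rightarrow> bool" where
  "two_valued V M \<longleftrightarrow>
     (\<forall>p\<in>preds V. \<forall>us\<in>tuples (universe M) (arity V p). interp M p us \<in> {Zero, One}) \<and>
     (\<forall>u\<in>universe M. \<forall>v\<in>universe M. interp M (eqsym V) [u, v] = (if u = v then One else Zero))"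

definition three_valued :: "'p vocab \<Rightarrow> ('p, 'u) struct \<Rightarrow> bool" where
  "three_valued V S \<longleftrightarrow>
     (\<forall>u\<in>universe S. interp S (eqsym V) [u, u] \<in> {One, Half}) \<and>
     (\<forall>u\<in>universe S. \<forall>v\<in>universe S. u \<noteq> v \<longrightarrow> interp S (eqsym V) [u, v] = Zero)"

definition embeds ::
  "'p vocab \<Rightarrow> ('u \<Rightarrow> 'v) \<Rightarrow> ('p, 'u) struct \<Rightarrow> ('p, 'v) struct \<Rightarrow> bool" where
  "embeds V f S S' \<longleftrightarrow>
     f ` universe S = universe S' \<and>
     (\<forall>p\<in>preds V. \<forall>us\<in>tuples (universe S) (arity V p). interp S p us \<sqsubseteq> interp S' p (map f us))"


section \<open>Formulas with transitive closure and monadic second-order quantification\<close>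

text \<open>
  Individual variables and set variables are two separate namespaces, both named by natural
  numbers. \<open>TC x y \<phi> a b\<close> is $(\mathit{TC}\ x, y : \varphi)(a, b)$, binding \<open>x\<close> and \<open>y\<close> in \<open>\<phi>\<close>.
\<close>

datatype 'p fm =
    Tru
  | Fls
  | Pred 'p "nat list"
  | Neg "'p fm"
  | And "'p fm" "'p fm"
  | Or "'p fm" "'p fm"
  | Imp "'p fm" "'p fm"
  | Exists nat "'p fm"
  | Forall nat "'p fm"
  | TC nat nat "'p fm" nat nat
  | Mem nat nat  \<comment> \<open>individual variable, set variable\<close>
  | ExistsSet nat "'p fm"

fun sat :: "('p, 'a) struct \<Rightarrow> (nat \<Rightarrow> 'a) \<Rightarrow> (nat \<Rightarrow> 'a set) \<Rightarrow> 'p fm \<Rightarrow> bool" where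
  "sat M e E Tru \<longleftrightarrow> True"
| "sat M e E Fls \<longleftrightarrow> False"
| "sat M e E (Pred p xs) \<longleftrightarrow> interp M p (map e xs) = One"
| "sat M e E (Neg \<phi>) \<longleftrightarrow> \<not> sat M e E \<phi>"
| "sat M e E (And \<phi> \<psi>) \<longleftrightarrow> sat M e E \<phi> \<and> sat M e E \<psi>"
| "sat M e E (Or \<phi> \<psi>) \<longleftrightarrow> sat M e E \<phi> \<or> sat M e E \<psi>"
| "sat M e E (Imp \<phi> \<psi>) \<longleftrightarrow> (sat M e E \<phi> \<longrightarrow> sat M e E \<psi>)"
| "sat M e E (Exists x \<phi>) \<longleftrightarrow> (\<exists>u\<in>universe M. sat M (e(x := u)) E \<phi>)"
| "sat M e E (Forall x \<phi>) \<longleftrightarrow> (\<forall>u\<in>universe M. sat M (e(x := u)) E \<phi>)"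
| "sat M e E (TC x y \<phi> a b) \<longleftrightarrow>
     (e a, e b) \<in> {(u, v). u \<in> universe M \<and> v \<in> universe M \<and> sat M (e(x := u, y := v)) E \<phi>}\<^sup>+"
| "sat M e E (Mem x X) \<longleftrightarrow> e x \<in> E X"
| "sat M e E (ExistsSet X \<phi>) \<longleftrightarrow> (\<exists>A. A \<subseteq> universe M \<and> sat M e (E(X := A)) \<phi>)"

text \<open>
  Satisfaction of closed formulas. Their truth value does not depend on the assignment, so all
  assignments are allowed here; restricting to assignments into \<open>universe M\<close> would make every formula
  true in the empty structure.
\<close>

definition models :: "('p, 'a) struct \<Rightarrow> 'p fm \<Rightarrow> bool" where
  "models M \<phi> \<longleftrightarrow> (\<forall>e E. sat M e E \<phi>)"

fun free_vars :: "'p fm \<Rightarrow> nat set" where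
  "free_vars Tru = {}"
| "free_vars Fls = {}"
| "free_vars (Pred p xs) = set xs"
| "free_vars (Neg \<phi>) = free_vars \<phi>"
| "free_vars (And \<phi> \<psi>) = free_vars \<phi> \<union> free_vars \<psi>"
| "free_vars (Or \<phi> \<psi>) = free_vars \<phi> \<union> free_vars \<psi>"
| "free_vars (Imp \<phi> \<psi>) = free_vars \<phi> \<union> free_vars \<psi>"
| "free_vars (Exists x \<phi>) = free_vars \<phi> - {x}"
| "free_vars (Forall x \<phi>) = free_vars \<phi> - {x}"
| "free_vars (TC x y \<phi> a b) = (free_vars \<phi> - {x, y}) \<union> {a, b}"
| "free_vars (Mem x X) = {x}"
| "free_vars (ExistsSet X \<phi>) = free_vars \<phi>"

text \<open>First-order formulas with transitive closure over a vocabulary (no set variables).\<close>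

fun fo_tc :: "'p vocab \<Rightarrow> 'p fm \<Rightarrow> bool" where
  "fo_tc V Tru \<longleftrightarrow> True"
| "fo_tc V Fls \<longleftrightarrow> True"
| "fo_tc V (Pred p xs) \<longleftrightarrow> p \<in> preds V \<and> length xs = arity V p"
| "fo_tc V (Neg \<phi>) \<longleftrightarrow> fo_tc V \<phi>"
| "fo_tc V (And \<phi> \<psi>) \<longleftrightarrow> fo_tc V \<phi> \<and> fo_tc V \<psi>"
| "fo_tc V (Or \<phi> \<psi>) \<longleftrightarrow> fo_tc V \<phi> \<and> fo_tc V \<psi>"
| "fo_tc V (Imp \<phi> \<psi>) \<longleftrightarrow> fo_tc V \<phi> \<and> fo_tc V \<psi>"
| "fo_tc V (Exists x \<phi>) \<longleftrightarrow> fo_tc V \<phi>"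
| "fo_tc V (Forall x \<phi>) \<longleftrightarrow> fo_tc V \<phi>"
| "fo_tc V (TC x y \<phi> a b) \<longleftrightarrow> x \<noteq> y \<and> fo_tc V \<phi>"
| "fo_tc V (Mem x X) \<longleftrightarrow> False"
| "fo_tc V (ExistsSet X \<phi>) \<longleftrightarrow> False"

definition fo_tc_sentence :: "'p vocab \<Rightarrow> 'p fm \<Rightarrow> bool" where
  "fo_tc_sentence V \<phi> \<longleftrightarrow> fo_tc V \<phi> \<and> free_vars \<phi> = {}"


section \<open>Concretization and its characteristic formula\<close>

definition \<gamma> :: "'p vocab \<Rightarrow> 'p fm \<Rightarrow> ('p, 'u) struct \<Rightarrow> ('p, 'a) struct set" where
  "\<gamma> V F S = {M. two_valued V M \<and> models M F \<and> (\<exists>f. embeds V f M S)}"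

definition conj_list :: "'p fm list \<Rightarrow> 'p fm" where
  "conj_list \<phi>s = foldr And \<phi>s Tru"

definition disj_list :: "'p fm list \<Rightarrow> 'p fm" where
  "disj_list \<phi>s = foldr Or \<phi>s Fls"

text \<open>Conjunction over a finite set, taken in an arbitrary order.\<close>

definition conj_set :: "'i set \<Rightarrow> ('i \<Rightarrow> 'p fm) \<Rightarrow> 'p fm" where
  "conj_set A f = conj_list (map f (SOME xs. distinct xs \<and> set xs = A))"

fun lit :: "'p \<Rightarrow> truth \<Rightarrow> nat list \<Rightarrow> 'p fm" where
  "lit p Zero xs = Neg (Pred p xs)"
| "lit p One xs = Pred p xs"
| "lit p Half xs = Tru"

text \<open>
  The universe is enumerated without repetition by the list \<open>us\<close>; the set variable of the
  individual \<open>us ! i\<close> is number \<open>i\<close>, counting from 0.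
\<close>

definition node :: "'u list \<Rightarrow> 'u \<Rightarrow> nat \<Rightarrow> 'p fm" where
  "node us u w = Mem w (THE i. i < length us \<and> us ! i = u)"

definition \<eta> :: "'p vocab \<Rightarrow> ('p, 'u) struct \<Rightarrow> 'u list \<Rightarrow> 'p fm" where
  "\<eta> V S us = (let n = length us in
     foldr ExistsSet [0..<n] (conj_list [
       conj_list [Exists i (Mem i i). i \<leftarrow> [0..<n]],
       conj_list [Forall 1 (Forall 2 (Imp (And (Mem 1 k) (Mem 2 j)) (Neg (Pred (eqsym V) [1, 2])))).
                  k \<leftarrow> [0..<n], j \<leftarrow> [0..<n], k \<noteq> j],
       Forall 0 (disj_list [Mem 0 i. i \<leftarrow> [0..<n]]),
       conj_set (preds_of_arity V 0) (\<lambda>p. lit p (interp S p []) []),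
       conj_list [conj_set (preds_of_arity V r) (\<lambda>p.
           foldr Forall [1..<Suc r] (conj_list [
             Imp (conj_list [node us (us' ! (j - 1)) j. j \<leftarrow> [1..<Suc r]])
                 (lit p (interp S p us') [1..<Suc r]).
             us' \<leftarrow> List.n_lists r us])).
         r \<leftarrow> [1..<Suc (maxR V)]]]))"

definition \<gamma>_NP :: "'p vocab \<Rightarrow> 'p fm \<Rightarrow> ('p, 'u) struct \<Rightarrow> 'u list \<Rightarrow> 'p fm" where
  "\<gamma>_NP V F S us = And F (\<eta> V S us)"

end

theory Submission
  imports Defs
begin

text \<open>
  A valuation of the set variables satisfies the matrix of \<open>\<eta> V S us\<close> exactly if its
  sets are the fibres of a map that embeds the structure into \<open>S\<close>: nonemptiness of the sets
  gives surjectivity, disjointness and covering make the map well defined, and the literals state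
  the information order pointwise.
\<close>

section \<open>Semantics of finite connectives and quantifier blocks\<close>

lemma sat_conj_list [simp]: "sat M e E (conj_list \<phi>s) \<longleftrightarrow> (\<forall>\<phi>\<in>set \<phi>s. sat M e E \<phi>)"
  unfolding conj_list_def by (induction \<phi>s) auto

lemma sat_disj_list [simp]: "sat M e E (disj_list \<phi>s) \<longleftrightarrow> (\<exists>\<phi>\<in>set \<phi>s. sat M e E \<phi>)"
  unfolding disj_list_def by (induction \<phi>s) auto

text \<open>Every finite set has a distinct enumeration, so the \<open>SOME\<close> term really
  lists \<open>A\<close>; the truth of a conjunction depends only on the set of its members, not on
  the order chosen.\<close>

lemma sat_conj_set:
  assumes "finite A"
  shows "sat M e E (conj_set A f) \<longleftrightarrow> (\<forall>x\<in>A. sat M e E (f x))"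
proof -
  have "set (SOME xs. distinct xs \<and> set xs = A) = A"
    using someI_ex[OF finite_distinct_list[OF assms]] by (simp add: conj_commute)
  then show ?thesis
    by (simp add: conj_set_def)
qed

text \<open>Merges the nested choices of sets into one valuation \<open>A\<close>, used only on the
  variables of the block. Repeated variables are allowed.\<close>

lemma sat_foldr_ExistsSet:
  "sat M e E (foldr ExistsSet Xs \<phi>) \<longleftrightarrow>
     (\<exists>A. (\<forall>X\<in>set Xs. A X \<subseteq> universe M) \<and> sat M e (override_on E A (set Xs)) \<phi>)"
proof (induction Xs arbitrary: E)
  case Nil
  then show ?case by simp
next
  case (Cons X Xs)
  show ?case
  proof
    assume "sat M e E (foldr ExistsSet (X # Xs) \<phi>)"
    then obtain B A where B: "B \<subseteq> universe M" and A: "\<forall>Y\<in>set Xs. A Y \<subseteq> universe M"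
      and sat: "sat M e (override_on (E(X := B)) A (set Xs)) \<phi>"
      by (auto simp: Cons.IH simp del: fun_upd_apply)
    \<comment> \<open>If \<open>X\<close> is bound again in \<open>Xs\<close>, the inner quantifier
      overwrites \<open>B\<close>; only otherwise does \<open>B\<close> survive as the value of
      \<open>X\<close>.\<close>
    let ?A = "if X \<in> set Xs then A else A(X := B)"
    have "override_on (E(X := B)) A (set Xs) = override_on E ?A (set (X # Xs))"
      by (auto simp: override_on_def fun_eq_iff)
    with A B sat show "\<exists>A. (\<forall>Y\<in>set (X # Xs). A Y \<subseteq> universe M) \<and>
        sat M e (override_on E A (set (X # Xs))) \<phi>"
      by (intro exI[of _ ?A]) auto
  next
    assume "\<exists>A. (\<forall>Y\<in>set (X # Xs). A Y \<subseteq> universe M) \<and>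
        sat M e (override_on E A (set (X # Xs))) \<phi>"
    then obtain A where A: "\<forall>Y\<in>set (X # Xs). A Y \<subseteq> universe M"
      and sat: "sat M e (override_on E A (set (X # Xs))) \<phi>"
      by blast
    have "override_on E A (set (X # Xs)) = override_on (E(X := A X)) A (set Xs)"
      by (auto simp: override_on_def fun_eq_iff)
    with A sat show "sat M e E (foldr ExistsSet (X # Xs) \<phi>)"
      by (auto simp: Cons.IH simp del: fun_upd_apply)
  qed
qed

lemma sat_foldr_Forall:
  "sat M e E (foldr Forall xs \<phi>) \<longleftrightarrow>
     (\<forall>a. (\<forall>x\<in>set xs. a x \<in> universe M) \<longrightarrow> sat M (override_on e a (set xs)) E \<phi>)"
proof (induction xs arbitrary: e)
  case Nil
  then show ?case by simp
next
  case (Cons x xs)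
  show ?case
  proof
    assume all: "sat M e E (foldr Forall (x # xs) \<phi>)"
    show "\<forall>a. (\<forall>y\<in>set (x # xs). a y \<in> universe M) \<longrightarrow>
        sat M (override_on e a (set (x # xs))) E \<phi>"
    proof (intro allI impI)
      fix a
      assume a: "\<forall>y\<in>set (x # xs). a y \<in> universe M"
      have "override_on e a (set (x # xs)) = override_on (e(x := a x)) a (set xs)"
        by (auto simp: override_on_def fun_eq_iff)
      with all a show "sat M (override_on e a (set (x # xs))) E \<phi>"
        by (auto simp: Cons.IH simp del: fun_upd_apply)
    qed
  next
    assume all: "\<forall>a. (\<forall>y\<in>set (x # xs). a y \<in> universe M) \<longrightarrow>
        sat M (override_on e a (set (x # xs))) E \<phi>"
    have "sat M (override_on (e(x := u)) a (set xs)) E \<phi>"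
      if "u \<in> universe M" and "\<forall>y\<in>set xs. a y \<in> universe M" for u a
    proof -
      let ?a = "if x \<in> set xs then a else a(x := u)"
      have "override_on (e(x := u)) a (set xs) = override_on e ?a (set (x # xs))"
        by (auto simp: override_on_def fun_eq_iff)
      moreover have "sat M (override_on e ?a (set (x # xs))) E \<phi>"
        using all that by (intro all[rule_format]) auto
      ultimately show ?thesis by simp
    qed
    then show "sat M e E (foldr Forall (x # xs) \<phi>)"
      by (auto simp: Cons.IH simp del: fun_upd_apply)
  qed
qed

lemma all_valuations_iff_all_tuples:
  "(\<forall>a. (\<forall>x\<in>set [1..<Suc r]. a x \<in> U) \<longrightarrow> P (map a [1..<Suc r])) \<longleftrightarrow>
     (\<forall>ws\<in>tuples U r. P ws)"
proof
  assume all: "\<forall>a. (\<forall>x\<in>set [1..<Suc r]. a x \<in> U) \<longrightarrow> P (map a [1..<Suc r])"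
  show "\<forall>ws\<in>tuples U r. P ws"
  proof
    fix ws
    assume ws: "ws \<in> tuples U r"
    \<comment> \<open>The variables are numbered from 1 and list positions from 0, so variable
      \<open>x\<close> carries component \<open>x - 1\<close>.\<close>
    have "map (\<lambda>x. ws ! (x - 1)) [1..<Suc r] = ws"
      using ws by (intro nth_equalityI) (auto simp: tuples_def simp del: upt_Suc)
    moreover have "\<forall>x\<in>set [1..<Suc r]. ws ! (x - 1) \<in> U"
      using ws by (auto simp: tuples_def simp del: upt_Suc intro!: subsetD[OF _ nth_mem])
    ultimately show "P ws"
      using all by metis
  qed
next
  have "map a [1..<Suc r] \<in> tuples U r" if "\<forall>x\<in>set [1..<Suc r]. a x \<in> U" for a
    using that by (auto simp: tuples_def simp del: upt_Suc)
  moreover assume "\<forall>ws\<in>tuples U r. P ws"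
  ultimately show "\<forall>a. (\<forall>x\<in>set [1..<Suc r]. a x \<in> U) \<longrightarrow> P (map a [1..<Suc r])"
    by blast
qed

section \<open>Literals, node formulas and the conjunct of one predicate\<close>

text \<open>Two-valuedness matters for \<open>b = Zero\<close>: the value \<open>Half\<close> would
  satisfy the negated atom without lying below \<open>Zero\<close>.\<close>

lemma sat_lit:
  assumes "interp M p (map e xs) \<in> {Zero, One}"
  shows "sat M e E (lit p b xs) \<longleftrightarrow> interp M p (map e xs) \<sqsubseteq> b"
  using assms by (cases b) (auto simp: info_le_def)

text \<open>The number of the set variable that \<open>node\<close> attaches to an
  individual.\<close>

definition index :: "'u list \<Rightarrow> 'u \<Rightarrow> nat" where
  "index us u = (THE i. i < length us \<and> us ! i = u)"

lemma index_nth: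
  assumes "distinct us" and "i < length us"
  shows "index us (us ! i) = i"
  unfolding index_def using assms by (auto simp: nth_eq_iff_index_eq)

lemma sat_node [simp]: "sat M e E (node us u w) \<longleftrightarrow> e w \<in> E (index us u)"
  by (simp add: node_def index_def)

lemma sat_predicate_conjunct:
  assumes two: "two_valued V M" and p: "p \<in> preds_of_arity V r"
  shows "sat M e E (foldr Forall [1..<Suc r] (conj_list [
             Imp (conj_list [node us (us' ! (j - 1)) j. j \<leftarrow> [1..<Suc r]])
                 (lit p (interp S p us') [1..<Suc r]).
             us' \<leftarrow> List.n_lists r us])) \<longleftrightarrow>
    (\<forall>ws\<in>tuples (universe M) r. \<forall>us'\<in>tuples (set us) r.
       (\<forall>j<r. ws ! j \<in> E (index us (us' ! j))) \<longrightarrow> interp M p ws \<sqsubseteq> interp S p us')"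
    (is "sat M e E (foldr Forall _ ?\<phi>) \<longleftrightarrow> (\<forall>ws\<in>_. ?P ws)")
proof -
  have "sat M (override_on e a (set [1..<Suc r])) E ?\<phi> \<longleftrightarrow> ?P (map a [1..<Suc r])"
    if a: "\<forall>x\<in>set [1..<Suc r]. a x \<in> universe M" for a
  proof -
    let ?e = "override_on e a (set [1..<Suc r])"
    have map_e: "map ?e [1..<Suc r] = map a [1..<Suc r]"
      by simp
    have "map a [1..<Suc r] \<in> tuples (universe M) (arity V p)"
      using a p by (auto simp: tuples_def preds_of_arity_def simp del: upt_Suc)
    then have "interp M p (map ?e [1..<Suc r]) \<in> {Zero, One}"
      using two p unfolding map_e two_valued_def preds_of_arity_def by blast
    then have lit: "sat M ?e E (lit p b [1..<Suc r]) \<longleftrightarrow>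
        interp M p (map a [1..<Suc r]) \<sqsubseteq> b" for b
      using sat_lit map_e by metis
    have nodes: "(\<forall>j\<in>set [1..<Suc r]. ?e j \<in> E (index us (us' ! (j - 1)))) \<longleftrightarrow>
        (\<forall>j<r. map a [1..<Suc r] ! j \<in> E (index us (us' ! j)))" for us'
    proof -
      have "(\<forall>j\<in>set [1..<Suc r]. ?e j \<in> E (index us (us' ! (j - 1)))) \<longleftrightarrow>
          (\<forall>j\<in>Suc ` {..<r}. a j \<in> E (index us (us' ! (j - 1))))"
        by (intro ball_cong) (auto simp: image_Suc_lessThan simp del: upt_Suc)
      then show ?thesis
        by (auto simp del: upt_Suc)
    qed
    show ?thesis
      using nodes by (simp add: lit set_n_lists tuples_def del: upt_Suc set_upt One_nat_def)
  qed
  then have "sat M e E (foldr Forall [1..<Suc r] ?\<phi>) \<longleftrightarrow>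
      (\<forall>a. (\<forall>x\<in>set [1..<Suc r]. a x \<in> universe M) \<longrightarrow> ?P (map a [1..<Suc r]))"
    unfolding sat_foldr_Forall by blast
  then show ?thesis
    unfolding all_valuations_iff_all_tuples[where P = ?P] .
qed

section \<open>The matrix of the characteristic formula as a condition on sets\<close>

text \<open>The matrix of \<open>\<eta>\<close> read semantically, with the atom for
  \<open>eqsym V\<close> replaced by true equality and all arities, including 0, treated uniformly.
  The bound \<open>A i \<subseteq> universe M\<close> stays outside because it comes from the set
  quantifiers.\<close>

definition fibres :: "'p vocab \<Rightarrow> ('p, 'u) struct \<Rightarrow> 'u list \<Rightarrow> ('p, 'a) struct \<Rightarrow>
    (nat \<Rightarrow> 'a set) \<Rightarrow> bool" where
  "fibres V S us M A \<longleftrightarrow>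
     (\<forall>i<length us. \<exists>u\<in>universe M. u \<in> A i) \<and>
     (\<forall>k<length us. \<forall>j<length us. k \<noteq> j \<longrightarrow>
        (\<forall>u\<in>universe M. \<forall>v\<in>universe M. u \<in> A k \<and> v \<in> A j \<longrightarrow> u \<noteq> v)) \<and>
     (\<forall>u\<in>universe M. \<exists>i<length us. u \<in> A i) \<and>
     (\<forall>p\<in>preds V. \<forall>ws\<in>tuples (universe M) (arity V p). \<forall>us'\<in>tuples (set us) (arity V p).
        (\<forall>j<arity V p. ws ! j \<in> A (index us (us' ! j))) \<longrightarrow> interp M p ws \<sqsubseteq> interp S p us')"

text \<open>Entries of \<open>us'\<close> are members of \<open>us\<close>, so their indices lie
  below \<open>length us\<close>. This allows the surrounding valuation \<open>E\<close> to be
  discarded.\<close>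

lemma fibres_cong:
  assumes "distinct us" and "\<And>i. i < length us \<Longrightarrow> A i = B i"
  shows "fibres V S us M A \<longleftrightarrow> fibres V S us M B"
proof -
  have "A (index us (us' ! j)) = B (index us (us' ! j))"
    if "us' \<in> tuples (set us) r" and "j < r" for us' r j
  proof -
    from that have "us' ! j \<in> set us"
      by (auto simp: tuples_def)
    then show ?thesis
      using assms by (metis in_set_conv_nth index_nth)
  qed
  then show ?thesis
    using assms(2) unfolding fibres_def by (simp cong: conj_cong)
qed

lemma sat_\<eta>:
  assumes voc: "vocabulary V" and two: "two_valued V M" and dist: "distinct us"
  shows "sat M e E (\<eta> V S us) \<longleftrightarrow>
    (\<exists>A. (\<forall>i<length us. A i \<subseteq> universe M) \<and> fibres V S us M A)"
proof -
  let ?n = "length us"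
  let ?Q = "\<lambda>A p r. \<forall>ws\<in>tuples (universe M) r. \<forall>us'\<in>tuples (set us) r.
        (\<forall>j<r. ws ! j \<in> A (index us (us' ! j))) \<longrightarrow> interp M p ws \<sqsubseteq> interp S p us'"
  have fin: "finite (preds_of_arity V r)" for r
    using voc by (simp add: vocabulary_def preds_of_arity_def)
  have le: "arity V p \<le> maxR V" if "p \<in> preds V" for p
    using voc that by (simp add: vocabulary_def maxR_def)
  \<comment> \<open>The empty list is the only tuple of length 0 and the node premise is vacuous, so
    a nullary literal fits the general pattern.\<close>
  have zero: "sat M e A (lit p (interp S p []) []) \<longleftrightarrow> ?Q A p 0"
    if "p \<in> preds_of_arity V 0" for p and A :: "nat \<Rightarrow> 'b set"
  proof -
    have "[] \<in> tuples (universe M) (arity V p)"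
      using that by (simp add: tuples_def preds_of_arity_def)
    then have "interp M p (map e []) \<in> {Zero, One}"
      using two that unfolding two_valued_def preds_of_arity_def by simp
    from sat_lit[OF this] show ?thesis
      by (simp add: tuples_def)
  qed
  have eq: "interp M (eqsym V) [u, v] = One \<longleftrightarrow> u = v"
    if "u \<in> universe M" "v \<in> universe M" for u v
    using two that by (simp add: two_valued_def)
  \<comment> \<open>The formula lists arity 0 apart from the arities 1 to \<open>maxR V\<close>; by
    \<open>le\<close> these exhaust the vocabulary.\<close>
  have split: "(\<forall>p\<in>preds V. ?Q A p (arity V p)) \<longleftrightarrow>
     (\<forall>p\<in>preds_of_arity V 0. ?Q A p 0) \<and>
     (\<forall>r\<in>set [1..<Suc (maxR V)]. \<forall>p\<in>preds_of_arity V r. ?Q A p r)" for A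
  proof -
    have "(\<forall>p\<in>preds V. R p (arity V p)) \<longleftrightarrow>
       (\<forall>p\<in>preds_of_arity V 0. R p 0) \<and>
       (\<forall>r\<in>set [1..<Suc (maxR V)]. \<forall>p\<in>preds_of_arity V r. R p r)" for R
    proof -
      have "arity V p = 0 \<or> arity V p \<in> set [1..<Suc (maxR V)]" if "p \<in> preds V" for p
        using le[OF that] by auto
      then show ?thesis
        unfolding preds_of_arity_def by (auto simp del: set_upt upt_Suc) metis
    qed
    then show ?thesis .
  qed
  have bounded: "(\<forall>i\<in>{0..<?n}. R i) \<longleftrightarrow> (\<forall>i<?n. R i)"
    "(\<forall>i\<in>{0..<?n} \<inter> {i. k \<noteq> i}. R i) \<longleftrightarrow> (\<forall>i<?n. k \<noteq> i \<longrightarrow> R i)"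
    "(\<exists>i\<in>{0..<?n}. R i) \<longleftrightarrow> (\<exists>i<?n. R i)" for R k
    by auto
  have "sat M e E (\<eta> V S us) \<longleftrightarrow> (\<exists>A. (\<forall>X\<in>set [0..<?n]. A X \<subseteq> universe M) \<and>
      fibres V S us M (override_on E A (set [0..<?n])))"
    unfolding \<eta>_def Let_def sat_foldr_ExistsSet fibres_def split
    by (simp add: sat_conj_set[OF fin] sat_predicate_conjunct[OF two] zero
        del: upt_Suc set_upt One_nat_def)
      (simp add: eq bounded del: upt_Suc One_nat_def cong: ball_cong conj_cong)
  also have "\<dots> \<longleftrightarrow> (\<exists>A. (\<forall>i<?n. A i \<subseteq> universe M) \<and> fibres V S us M A)"
  proof -
    have "fibres V S us M (override_on E A (set [0..<?n])) \<longleftrightarrow> fibres V S us M A" for A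
      by (rule fibres_cong[OF dist]) simp
    then show ?thesis
      by (simp add: bounded)
  qed
  finally show ?thesis .
qed

section \<open>Embeddings and their fibres\<close>

lemma fibres_of_embedding:
  assumes dist: "distinct us" and univ: "universe S = set us" and emb: "embeds V f M S"
  shows "fibres V S us M (\<lambda>i. {w \<in> universe M. f w = us ! i})"
proof -
  have img: "f ` universe M = set us"
    using emb univ by (simp add: embeds_def)
  have "interp M p ws \<sqsubseteq> interp S p us'"
    if p: "p \<in> preds V" and ws: "ws \<in> tuples (universe M) (arity V p)"
      and us': "us' \<in> tuples (set us) (arity V p)"
      and nodes: "\<forall>j<arity V p. f (ws ! j) = us ! index us (us' ! j)" for p ws us'
  proof -
    have "us ! index us u = u" if "u \<in> set us" for u
      using that dist by (metis in_set_conv_nth index_nth)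
    \<comment> \<open>The node premise forces \<open>us'\<close> to be the image of
      \<open>ws\<close> under \<open>f\<close>, the one tuple about which the embedding makes a
      claim.\<close>
    then have "map f ws = us'"
      using ws us' nodes by (intro nth_equalityI) (auto simp: tuples_def subset_iff)
    then show ?thesis
      using emb p ws unfolding embeds_def by blast
  qed
  moreover have "\<exists>u\<in>universe M. f u = us ! i" if "i < length us" for i
    using that img nth_mem[OF that] by (metis imageE)
  moreover have "\<exists>i<length us. f u = us ! i" if "u \<in> universe M" for u
    using that img by (metis imageI in_set_conv_nth)
  ultimately show ?thesis
    using dist unfolding fibres_def by (auto simp: nth_eq_iff_index_eq)
qed

lemma embedding_of_fibres:
  assumes dist: "distinct us" and univ: "universe S = set us" and fib: "fibres V S us M A"
  shows "\<exists>f. embeds V f M S"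
proof -
  have "\<forall>u\<in>universe M. \<exists>i<length us. u \<in> A i"
    using fib by (simp add: fibres_def)
  \<comment> \<open>Covering lets \<open>g\<close> choose for each element a set containing it; the
    embedding sends the element to the individual with that number.\<close>
  then obtain g where g: "\<And>u. u \<in> universe M \<Longrightarrow> g u < length us \<and> u \<in> A (g u)"
    by metis
  let ?f = "\<lambda>u. us ! g u"
  have "us ! i \<in> ?f ` universe M" if i: "i < length us" for i
  proof -
    obtain u where u: "u \<in> universe M" "u \<in> A i"
      using fib i by (auto simp: fibres_def)
    \<comment> \<open>\<open>u\<close> lies in both \<open>A i\<close> and \<open>A (g u)\<close>;
      for different numbers, disjointness would give \<open>u \<noteq> u\<close>. Thus nonempty sets
      yield surjectivity.\<close>
    then have "g u = i"
      using fib i g[OF u(1)] unfolding fibres_def by blast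
    with u show ?thesis
      by blast
  qed
  then have "?f ` universe M = universe S"
    using g univ by (force simp: in_set_conv_nth)
  moreover have "interp M p ws \<sqsubseteq> interp S p (map ?f ws)"
    if p: "p \<in> preds V" and ws: "ws \<in> tuples (universe M) (arity V p)" for p ws
  proof -
    have "map ?f ws \<in> tuples (set us) (arity V p)"
      using ws g by (auto simp: tuples_def)
    \<comment> \<open>As \<open>us\<close> is distinct, the index of \<open>us ! g u\<close> is
      \<open>g u\<close>, and \<open>u\<close> lies in \<open>A (g u)\<close>; so the image tuple
      meets the node premise.\<close>
    moreover have "\<forall>j<arity V p. ws ! j \<in> A (index us (map ?f ws ! j))"
      using ws g by (auto simp: tuples_def subset_iff index_nth[OF dist])
    ultimately show ?thesis
      using fib p ws unfolding fibres_def by blast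
  qed
  ultimately show ?thesis
    unfolding embeds_def by blast
qed

theorem theorem3:
  fixes V :: "'p vocab" and F :: "'p fm"
    and S :: "('p, 'u) struct" and us :: "'u list"
    and M :: "('p, 'a) struct"
  assumes "vocabulary V"
    and "fo_tc_sentence V F"
    and "three_valued V S"
    and "distinct us" and "universe S = set us"
    and "two_valued V M"
  shows "M \<in> \<gamma> V F S \<longleftrightarrow> models M (\<gamma>_NP V F S us)"
proof -
  \<comment> \<open>Proved for every assignment: the right side mentions neither \<open>e\<close>
    nor \<open>E\<close>, so the quantification in \<open>models\<close> is left to act on
    \<open>F\<close> alone.\<close>
  have "sat M e E (\<eta> V S us) \<longleftrightarrow> (\<exists>f. embeds V f M S)" for e E
  proof
    assume "sat M e E (\<eta> V S us)"
    then show "\<exists>f. embeds V f M S"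
      unfolding sat_\<eta>[OF assms(1,6,4)] using embedding_of_fibres[OF assms(4,5)] by blast
  next
    assume "\<exists>f. embeds V f M S"
    then obtain f where "embeds V f M S" ..
    then have "fibres V S us M (\<lambda>i. {w \<in> universe M. f w = us ! i})"
      by (rule fibres_of_embedding[OF assms(4,5)])
    then show "sat M e E (\<eta> V S us)"
      unfolding sat_\<eta>[OF assms(1,6,4)] by (intro exI[of _ "\<lambda>i. {w \<in> universe M. f w = us ! i}"]) auto
  qed
  then show ?thesis
    using assms(6) by (auto simp: \<gamma>_def \<gamma>_NP_def models_def)
qed

end
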